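(* Fix constants $\tau\ge\epsilon>0$ independent of $n$ and let $a>1$. Place $n$ sensors on $[0,\infty)$ at the first $n$ arrival times $X_1<\dots<X_n$ of a homogeneous Poisson process on $[0,\infty)$ with rate $n$. Then any sensor displacement algorithm which solves the $\left(\frac{1+\epsilon}{n},\frac{1+\tau}{n}\right)$-interference problem requires expected $a$-total movement of at least $\Omega(n)$.
   Context: A sensor displacement algorithm assigns to each sensor (as a function of the initial positions) a final position in $[0,\infty)$. For $0<s\le v$, it solves the $(s,v)$-interference problem if, in the final configuration, every two consecutive sensors (consecutive in the order of final positions) are at distance at least $s$ and at most $v$. If the $i$-th sensor is displaced by a distance $|m(i)|$, the $a$-total movement is $\sum_{i=1}^n|m(i)|^a$. Asymptotics are as $n\to\infty$. *)

theory Defs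
  imports "HOL-Probability.Probability"
begin

text \<open>Homogeneous Poisson process on $[0,\infty)$, given by its counting process \<open>N\<close>:
  \<open>N t \<omega>\<close> is the number of arrivals in $[0,t]$.  The increments below use subtraction on
  \<open>nat\<close>, which does not truncate because the paths are nondecreasing.\<close>

locale poisson_process = prob_space M for M :: "'w measure" +
  fixes rate :: real and N :: "real \<Rightarrow> 'w \<Rightarrow> nat"
  assumes rate_pos: "0 < rate"
    and measurable_count: "\<And>t. 0 \<le> t \<Longrightarrow> N t \<in> measurable M (count_space UNIV)"
    and starts_at_0: "\<And>\<omega>. \<omega> \<in> space M \<Longrightarrow> N 0 \<omega> = 0"
    and nondecreasing: "\<And>\<omega>. \<omega> \<in> space M \<Longrightarrow> mono_on {0..} (\<lambda>t. N t \<omega>)"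
    and right_continuous:
      "\<And>\<omega> t. \<omega> \<in> space M \<Longrightarrow> 0 \<le> t \<Longrightarrow> ((\<lambda>u. N u \<omega>) \<longlongrightarrow> N t \<omega>) (at_right t)"
    and independent_increments:
      "\<And>(t :: nat \<Rightarrow> real) m. 0 \<le> t 0 \<Longrightarrow> mono_on {..m} t \<Longrightarrow>
         indep_vars (\<lambda>_. count_space UNIV) (\<lambda>i \<omega>. N (t (Suc i)) \<omega> - N (t i) \<omega>) {..<m}"
    and poisson_increments:
      "\<And>s t. 0 \<le> s \<Longrightarrow> s < t \<Longrightarrow>
         distr M (count_space UNIV) (\<lambda>\<omega>. N t \<omega> - N s \<omega>)
           = measure_pmf (poisson_pmf (rate * (t - s)))"

text \<open>The \<open>k\<close>-th arrival time, for \<open>k \<ge> 1\<close>.  Almost surely the set is nonempty and the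
  arrival times are strictly increasing in \<open>k\<close>.\<close>

definition arrival_time :: "(real \<Rightarrow> 'w \<Rightarrow> nat) \<Rightarrow> nat \<Rightarrow> 'w \<Rightarrow> real" where
  "arrival_time N k \<omega> = Inf {t. 0 \<le> t \<and> k \<le> N t \<omega>}"

text \<open>Sensors are numbered \<open>1, \<dots>, n\<close>; a configuration is a function \<open>nat \<Rightarrow> real\<close> of which only
  the values on \<open>{1..n}\<close> matter.  An initial configuration is \<open>undefined\<close> outside \<open>{1..n}\<close>, so
  that an algorithm can use no other information than the initial positions of the \<open>n\<close> sensors.\<close>

definition initial_configurations :: "nat \<Rightarrow> (nat \<Rightarrow> real) set" where
  "initial_configurations n = {x \<in> {1..n} \<rightarrow>\<^sub>E {0..}. strict_mono_on {1..n} x}"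

definition arrival_configuration :: "nat \<Rightarrow> (real \<Rightarrow> 'w \<Rightarrow> nat) \<Rightarrow> 'w \<Rightarrow> nat \<Rightarrow> real" where
  "arrival_configuration n N \<omega> = (\<lambda>i\<in>{1..n}. arrival_time N i \<omega>)"

text \<open>Sensors sharing a position are consecutive, at distance \<open>0\<close>.\<close>

definition consecutive_distances_within :: "nat \<Rightarrow> real \<Rightarrow> real \<Rightarrow> (nat \<Rightarrow> real) \<Rightarrow> bool" where
  "consecutive_distances_within n s v y \<longleftrightarrow>
     (let ys = sort (map y [1..<Suc n])
      in \<forall>k. Suc k < n \<longrightarrow> s \<le> ys ! Suc k - ys ! k \<and> ys ! Suc k - ys ! k \<le> v)"

definition solves_interference ::
    "nat \<Rightarrow> real \<Rightarrow> real \<Rightarrow> ((nat \<Rightarrow> real) \<Rightarrow> nat \<Rightarrow> real) \<Rightarrow> bool" where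
  "solves_interference n s v A \<longleftrightarrow>
     (\<forall>x\<in>initial_configurations n.
        (\<forall>i\<in>{1..n}. 0 \<le> A x i) \<and> consecutive_distances_within n s v (A x))"

definition total_movement :: "real \<Rightarrow> nat \<Rightarrow> (nat \<Rightarrow> real) \<Rightarrow> (nat \<Rightarrow> real) \<Rightarrow> real" where
  "total_movement a n x y = (\<Sum>i=1..n. \<bar>y i - x i\<bar> powr a)"

text \<open>The expectation may be infinite, hence the nonnegative integral.  Algorithms are not
  required to be measurable; for a non-measurable integrand this is the lower integral, so a
  lower bound on it is the strongest possible one.\<close>

definition expected_total_movement ::
    "real \<Rightarrow> nat \<Rightarrow> 'w measure \<Rightarrow> (real \<Rightarrow> 'w \<Rightarrow> nat) \<Rightarrow> ((nat \<Rightarrow> real) \<Rightarrow> nat \<Rightarrow> real) \<Rightarrow> ennreal"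
where
  "expected_total_movement a n M N A =
     (\<integral>\<^sup>+ \<omega>. ennreal (total_movement a n (arrival_configuration n N \<omega>)
                        (A (arrival_configuration n N \<omega>))) \<partial>M)"

end

theory Submission
  imports Defs
begin

text \<open>The gaps of the final configuration push the sum of all final positions up to at least
  \<open>s n (n - 1) / 2 = (1 + \<epsilon>) (n - 1) / 2\<close>, whichever sensor ends up where, while the expected sum
  of the arrival times is only \<open>\<Sum>i\<le>n. i / n = (n + 1) / 2\<close>, the \<open>i\<close>-th one being Erlang
  distributed.  So the expected total displacement is at least about \<open>\<epsilon> n / 2\<close>, and the
  inequality \<open>x\<^sup>a \<ge> d\<^sup>a\<^sup>-\<^sup>1 (x - d)\<close> with \<open>d = \<epsilon> / 4\<close> turns this into a linear bound on the
  \<open>a\<close>-total movement.\<close>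

section \<open>Distribution of counts and increments\<close>

lemma (in poisson_process) measurable_count' [measurable]:
  "0 \<le> t \<Longrightarrow> random_variable (count_space UNIV) (N t)"
  by (rule measurable_count)

lemma (in poisson_process) count_mono:
  "\<omega> \<in> space M \<Longrightarrow> 0 \<le> s \<Longrightarrow> s \<le> t \<Longrightarrow> N s \<omega> \<le> N t \<omega>"
  using nondecreasing by (auto simp: mono_on_def)

lemma (in poisson_process) prob_increment:
  assumes "0 \<le> s" "s < t"
  shows "prob {\<omega>\<in>space M. N t \<omega> - N s \<omega> \<in> B} = measure (poisson_pmf (rate * (t - s))) B"
proof -
  have "measure (poisson_pmf (rate * (t - s))) B
      = measure (distr M (count_space UNIV) (\<lambda>\<omega>. N t \<omega> - N s \<omega>)) B"
    using poisson_increments[OF assms] by simp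
  also have "\<dots> = prob ((\<lambda>\<omega>. N t \<omega> - N s \<omega>) -` B \<inter> space M)"
    using assms by (intro measure_distr) measurable
  also have "(\<lambda>\<omega>. N t \<omega> - N s \<omega>) -` B \<inter> space M = {\<omega>\<in>space M. N t \<omega> - N s \<omega> \<in> B}"
    by auto
  finally show ?thesis by simp
qed

lemma (in poisson_process) prob_count:
  assumes "0 < t"
  shows "prob {\<omega>\<in>space M. N t \<omega> \<in> B} = measure (poisson_pmf (rate * t)) B"
proof -
  have "{\<omega>\<in>space M. N t \<omega> \<in> B} = {\<omega>\<in>space M. N t \<omega> - N 0 \<omega> \<in> B}"
    using starts_at_0 by auto
  with prob_increment[of 0 t B] assms show ?thesis by simp
qed

lemma measure_poisson_atMost:
  assumes "0 < r"
  shows "measure (poisson_pmf r) {..k} = (\<Sum>j\<le>k. r ^ j / fact j * exp (- r))"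
  using assms by (simp add: measure_measure_pmf_finite)

lemma (in poisson_process) prob_count_le:
  assumes "0 < t"
  shows "prob {\<omega>\<in>space M. N t \<omega> \<le> k} = (\<Sum>j\<le>k. (rate * t) ^ j / fact j * exp (- (rate * t)))"
  using prob_count[OF assms, of "{..k}"] measure_poisson_atMost[of "rate * t" k] assms rate_pos
  by simp

text \<open>The complement has mass \<open>(1 + r) * exp (- r)\<close>, and \<open>exp (- r)\<close>
  is at least \<open>1 - r\<close>. What matters is the quadratic order: over \<open>K\<close> cells
  of mean proportional to \<open>1 / K\<close> such bounds add up to order
  \<open>1 / K\<close>.\<close>

lemma measure_poisson_ge_2:
  assumes "0 < r"
  shows "measure (poisson_pmf r) {2..} \<le> r\<^sup>2"
proof -
  have "{2..} = space (measure_pmf (poisson_pmf r)) - {..1::nat}" by auto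
  then have "measure (poisson_pmf r) {2..} = 1 - measure (poisson_pmf r) {..1}"
    using measure_pmf.prob_compl[of "{..1}" "poisson_pmf r"] by simp
  also have "\<dots> = 1 - (1 + r) * exp (- r)"
    using assms by (subst measure_poisson_atMost) (auto simp: algebra_simps)
  also have "\<dots> \<le> 1 - (1 + r) * (1 - r)"
    using assms exp_ge_add_one_self[of "-r"] by (intro diff_left_mono mult_left_mono) auto
  finally show ?thesis by (simp add: algebra_simps power2_eq_square)
qed

section \<open>Arrival times: inversion of the counting process, measurability, Erlang law\<close>

text \<open>Right continuity makes the infimum attained; \<open>ex\<close> keeps it away from
  \<open>Inf {}\<close>.\<close>

lemma (in poisson_process) arrival_time_le_iff:
  assumes \<omega>: "\<omega> \<in> space M" and ex: "\<exists>u\<ge>0. k \<le> N u \<omega>" and t: "0 \<le> t"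
  shows "arrival_time N k \<omega> \<le> t \<longleftrightarrow> k \<le> N t \<omega>"
proof
  assume "k \<le> N t \<omega>"
  then show "arrival_time N k \<omega> \<le> t"
    unfolding arrival_time_def using t by (intro cInf_lower) (auto intro!: bdd_belowI[of _ 0])
next
  assume le: "arrival_time N k \<omega> \<le> t"
  \<comment> \<open>Counts are discrete, so convergence from the right means that the path is
    constant just after \<open>t\<close>. A time \<open>u < b\<close> with \<open>k\<close> arrivals
    then forces \<open>k\<close> arrivals at \<open>t\<close>, by monotonicity or by this
    constancy.\<close>
  have "\<forall>\<^sub>F u in at_right t. N u \<omega> = N t \<omega>"
    using right_continuous[OF \<omega> t] by (simp add: tendsto_discrete)
  then obtain b where b: "t < b" "\<And>u. t < u \<Longrightarrow> u < b \<Longrightarrow> N u \<omega> = N t \<omega>"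
    unfolding eventually_at_right_field by auto
  have "Inf {t. 0 \<le> t \<and> k \<le> N t \<omega>} < b"
    using le b(1) unfolding arrival_time_def by simp
  then obtain u where u: "0 \<le> u" "k \<le> N u \<omega>" "u < b"
    using ex by (subst (asm) cInf_less_iff) (auto intro!: bdd_belowI[of _ 0])
  show "k \<le> N t \<omega>"
  proof (cases "u \<le> t")
    case True
    with count_mono[OF \<omega> u(1)] u(2) show ?thesis by force
  next
    case False
    with b(2)[of u] u show ?thesis by simp
  qed
qed

lemma (in poisson_process) arrival_time_nonneg:
  assumes "\<exists>u\<ge>0. k \<le> N u \<omega>"
  shows "0 \<le> arrival_time N k \<omega>"
  unfolding arrival_time_def using assms by (intro cInf_greatest) auto

text \<open>Having at most \<open>k\<close> arrivals ever implies having at most \<open>k\<close> by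
  time \<open>m\<close>, and this Poisson probability vanishes as \<open>m\<close> grows.\<close>

lemma (in poisson_process) AE_count_unbounded: "AE \<omega> in M. \<forall>k. \<exists>u\<ge>0. k \<le> N u \<omega>"
proof -
  have "AE \<omega> in M. \<exists>u\<ge>0. Suc k \<le> N u \<omega>" for k
  proof (rule AE_I)
    \<comment> \<open>Integer times make this a countable intersection, hence an event.\<close>
    define E where "E = {\<omega>\<in>space M. \<forall>m::nat. N (real m) \<omega> \<le> k}"
    show "{\<omega>\<in>space M. \<not> (\<exists>u\<ge>0. Suc k \<le> N u \<omega>)} \<subseteq> E"
      unfolding E_def using of_nat_0_le_iff by (auto simp: not_less_eq_eq)
    show E: "E \<in> events" unfolding E_def by measurable
    have le: "prob E \<le> (\<Sum>j\<le>k. (rate * x) ^ j / exp (rate * x))"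
      if m: "0 < m" and x: "x = real m" for m x
    proof -
      have "prob E \<le> prob {\<omega>\<in>space M. N (real m) \<omega> \<le> k}"
        by (rule finite_measure_mono) (auto simp: E_def)
      also have "\<dots> = (\<Sum>j\<le>k. (rate * x) ^ j / fact j * exp (- (rate * x)))"
        using m by (simp add: prob_count_le x)
      also have "\<dots> \<le> (\<Sum>j\<le>k. (rate * x) ^ j / exp (rate * x))"
      proof (rule sum_mono)
        fix j
        have "(rate * x) ^ j / fact j \<le> (rate * x) ^ j / 1"
          using rate_pos x by (intro divide_left_mono) (auto simp: fact_ge_1)
        then show "(rate * x) ^ j / fact j * exp (- (rate * x)) \<le> (rate * x) ^ j / exp (rate * x)"
          using mult_right_mono[of _ _ "exp (- (rate * x))"]
          by (metis div_by_1 divide_inverse exp_ge_zero exp_minus)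
      qed
      finally show ?thesis .
    qed
    have "(\<lambda>m. \<Sum>j\<le>k. (rate * real m) ^ j / exp (rate * real m)) \<longlonglongrightarrow> (\<Sum>j\<le>k. 0)"
      using rate_pos
      by (intro tendsto_sum filterlim_compose[OF tendsto_power_div_exp_0]
          filterlim_tendsto_pos_mult_at_top[OF tendsto_const] filterlim_real_sequentially)
    then have "prob E \<le> (\<Sum>j\<le>k. 0)"
      by (rule tendsto_lowerbound)
        (auto intro!: le[OF _ refl] exI[of _ 1] simp: eventually_sequentially)
    then show "emeasure M E = 0"
      by (simp add: emeasure_eq_measure measure_le_0_iff)
  qed
  then have "AE \<omega> in M. \<forall>k. \<exists>u\<ge>0. Suc k \<le> N u \<omega>" by (simp add: AE_all_countable)
  then show ?thesis by eventually_elim (meson Suc_leD)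
qed

text \<open>On the null event that fewer than \<open>k\<close> arrivals ever occur, the arrival time is the
  unspecified real number \<open>Inf {}\<close>.\<close>

lemma (in poisson_process) arrival_time_le_iff_total:
  assumes \<omega>: "\<omega> \<in> space M"
  shows "arrival_time N k \<omega> \<le> t \<longleftrightarrow>
    0 \<le> t \<and> k \<le> N t \<omega> \<or> (\<forall>m::nat. N (real m) \<omega> < k) \<and> Inf {} \<le> t"
proof (cases "\<exists>u\<ge>0. k \<le> N u \<omega>")
  case True
  then obtain u where u: "0 \<le> u" "k \<le> N u \<omega>" by blast
  have "N u \<omega> \<le> N (real (nat \<lceil>u\<rceil>)) \<omega>" using u \<omega> by (intro count_mono) linarith+
  with u have "\<not> (\<forall>m::nat. N (real m) \<omega> < k)" by (meson not_less order_trans)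
  with arrival_time_le_iff[OF \<omega> True] arrival_time_nonneg[OF True] show ?thesis
    by (metis order_trans)
next
  case False
  then have "{t. 0 \<le> t \<and> k \<le> N t \<omega>} = {}" by auto
  then have "arrival_time N k \<omega> = Inf {}" unfolding arrival_time_def by (simp only:)
  moreover have "\<forall>m::nat. N (real m) \<omega> < k" using False by (metis not_less of_nat_0_le_iff)
  ultimately show ?thesis using False by auto
qed

lemma (in poisson_process) borel_measurable_arrival_time [measurable]:
  "arrival_time N k \<in> borel_measurable M"
proof (rule borel_measurableI_le)
  fix t
  have "{\<omega>\<in>space M. arrival_time N k \<omega> \<le> t}
      = {\<omega>\<in>space M. 0 \<le> t \<and> k \<le> N t \<omega> \<or> (\<forall>m::nat. N (real m) \<omega> < k) \<and> Inf {} \<le> t}"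
    using arrival_time_le_iff_total by blast
  also have "\<dots> \<in> events"
    by (cases "0 \<le> t") auto
  finally show "{\<omega>\<in>space M. arrival_time N k \<omega> \<le> t} \<in> events" .
qed

text \<open>Up to a null set, arrival by time \<open>t\<close> is the complement of
  \<open>N t \<omega> \<le> k\<close>, and the Poisson sum for the latter is the tail of the Erlang
  distribution. The library's parameter \<open>k\<close> stands for shape \<open>k + 1\<close>,
  hence \<open>Suc k\<close>.\<close>

lemma (in poisson_process) distributed_arrival_time:
  "distributed M lborel (arrival_time N (Suc k)) (erlang_density k rate)"
proof (rule erlang_distributedI)
  fix t :: real assume t: "0 \<le> t"
  have "emeasure M {\<omega>\<in>space M. arrival_time N (Suc k) \<omega> \<le> t}
      = emeasure M {\<omega>\<in>space M. Suc k \<le> N t \<omega>}"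
  proof (rule emeasure_eq_AE)
    show "AE \<omega> in M. \<omega> \<in> {\<omega>\<in>space M. arrival_time N (Suc k) \<omega> \<le> t}
        \<longleftrightarrow> \<omega> \<in> {\<omega>\<in>space M. Suc k \<le> N t \<omega>}"
      using AE_count_unbounded AE_space
      by eventually_elim (use t in \<open>auto simp: arrival_time_le_iff\<close>)
  qed (use t in measurable)
  also have "\<dots> = ennreal (1 - prob {\<omega>\<in>space M. N t \<omega> \<le> k})"
    using t by (subst prob_compl[symmetric])
      (auto simp: emeasure_eq_measure intro!: arg_cong[where f=prob])
  also have "1 - prob {\<omega>\<in>space M. N t \<omega> \<le> k} = erlang_CDF k rate t"
  \<comment> \<open>The Poisson law covers intervals of positive length only; time \<open>0\<close>
    is settled by \<open>starts_at_0\<close>.\<close>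
  proof (cases "t = 0")
    case True
    then have "{\<omega>\<in>space M. N t \<omega> \<le> k} = space M" by (auto simp: starts_at_0)
    then show ?thesis by (simp add: True erlang_CDF_at0 prob_space)
  next
    case False
    with t rate_pos show ?thesis
      by (simp add: prob_count_le erlang_CDF_def)
  qed
  finally show "emeasure M {\<omega>\<in>space M. arrival_time N (Suc k) \<omega> \<le> t} = erlang_CDF k rate t" .
qed (use rate_pos in auto)

lemma (in poisson_process) expectation_arrival_time:
  assumes "1 \<le> i"
  shows "integrable M (arrival_time N i)" and "expectation (arrival_time N i) = real i / rate"
proof -
  obtain k where i: "i = Suc k" using assms by (cases i) auto
  show "integrable M (arrival_time N i)"
    using erlang_ith_moment_integrable[OF rate_pos distributed_arrival_time[of k], of 1] i by simp
  show "expectation (arrival_time N i) = real i / rate"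
    using erlang_ith_moment[OF rate_pos distributed_arrival_time[of k], of 1] i by simp
qed

section \<open>Almost sure distinctness of the arrivals\<close>

text \<open>By the union bound, the grid with \<open>K\<close> cells fails with probability at most
  \<open>(rate * T)\<^sup>2 / K\<close>. Failure of all grids at once is bounded by each of these,
  so it is null.\<close>

lemma (in poisson_process) AE_grid_increments_le_1:
  assumes T: "0 < T"
  shows "AE \<omega> in M. \<exists>K>0. \<forall>j<K. N (T * real (Suc j) / real K) \<omega> - N (T * real j / real K) \<omega> \<le> 1"
proof (rule AE_I)
  define F where
    "F K j = {\<omega>\<in>space M. N (T * real (Suc j) / real K) \<omega> - N (T * real j / real K) \<omega> \<in> {2..}}" for K j
  define E where "E = {\<omega>\<in>space M. \<forall>K>0. \<exists>j<K.
    N (T * real (Suc j) / real K) \<omega> - N (T * real j / real K) \<omega> \<in> {2..}}"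
  have [measurable]: "random_variable (count_space UNIV) (N (T * real j / real K))" for j K
    using T by (intro measurable_count) auto
  have F [measurable]: "F K j \<in> events" for K j
    unfolding F_def by measurable
  show "{\<omega>\<in>space M. \<not> (\<exists>K>0. \<forall>j<K. N (T * real (Suc j) / real K) \<omega> - N (T * real j / real K) \<omega> \<le> 1)} \<subseteq> E"
    proof -
    have "b - c \<in> {2..} \<longleftrightarrow> \<not> b - c \<le> 1" for b c :: nat by auto
    then show ?thesis unfolding E_def by (simp only:) blast
  qed
  show E: "E \<in> events" unfolding E_def by measurable
  have le: "prob E \<le> (rate * T)\<^sup>2 / real K" if K: "0 < K" for K
  proof -
    have "prob E \<le> prob (\<Union>j<K. F K j)"
      proof (rule finite_measure_mono)
      show "E \<subseteq> (\<Union>j<K. F K j)" using K unfolding E_def F_def by blast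
    qed (intro sets.finite_UN finite_lessThan F)
    also have "\<dots> \<le> (\<Sum>j<K. prob (F K j))"
      by (intro finite_measure_subadditive_finite) auto
    also have "\<dots> \<le> (\<Sum>j<K. (rate * T / real K)\<^sup>2)"
    proof (rule sum_mono)
      fix j
      have "T * real (Suc j) / real K - T * real j / real K = T / real K"
        using K by (simp add: field_simps)
      then have "prob (F K j) = measure (poisson_pmf (rate * (T / real K))) {2..}"
        unfolding F_def using T K by (subst prob_increment) (auto simp: field_simps)
      also have "\<dots> \<le> (rate * T / real K)\<^sup>2"
        using measure_poisson_ge_2[of "rate * (T / real K)"] rate_pos T K by simp
      finally show "prob (F K j) \<le> (rate * T / real K)\<^sup>2" .
    qed
    also have "\<dots> = (rate * T)\<^sup>2 / real K"
      using K by (simp add: power_divide power2_eq_square)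
    finally show ?thesis .
  qed
  have "prob E \<le> 0"
    by (rule tendsto_lowerbound[OF lim_const_over_n[of "(rate * T)\<^sup>2"]])
      (auto intro!: le exI[of _ 1] simp: eventually_sequentially)
  then show "emeasure M E = 0"
    by (simp add: emeasure_eq_measure measure_le_0_iff)
qed

text \<open>Two simultaneous arrivals at \<open>t\<close> would force an increment of at least \<open>2\<close> in the cell
  containing \<open>t\<close> of every grid.\<close>

lemma (in poisson_process) AE_arrival_time_strict_mono:
  "AE \<omega> in M. \<forall>k\<ge>1. arrival_time N k \<omega> < arrival_time N (Suc k) \<omega>"
proof -
  \<comment> \<open>Countably many horizons \<open>Suc m\<close> share one null set, so the horizon
    may later depend on \<open>\<omega>\<close>.\<close>
  have grids: "AE \<omega> in M. \<forall>m. \<exists>K>0. \<forall>j<K.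
      N (real (Suc m) * real (Suc j) / real K) \<omega> - N (real (Suc m) * real j / real K) \<omega> \<le> 1"
    using AE_grid_increments_le_1 by (subst AE_all_countable) simp
  show ?thesis
    using grids AE_count_unbounded AE_space
  proof eventually_elim
    case (elim \<omega>)
    have iff: "arrival_time N k \<omega> \<le> t \<longleftrightarrow> k \<le> N t \<omega>" if "0 \<le> t" for k t
      using arrival_time_le_iff[OF elim(3) _ that] elim(2) by blast
    show ?case
    proof (intro allI impI, rule ccontr)
      fix k :: nat
      define t where "t = arrival_time N k \<omega>"
      assume k: "1 \<le> k" and "\<not> arrival_time N k \<omega> < arrival_time N (Suc k) \<omega>"
      then have simultaneous: "arrival_time N (Suc k) \<omega> \<le> t" by (simp add: t_def)
      have t: "0 < t"
        using iff[of 0 k] starts_at_0[OF elim(3)] k by (simp add: t_def)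
      define m where "m = nat \<lceil>t\<rceil>"
      have tm: "t < real (Suc m)" unfolding m_def by linarith
      obtain K where K: "0 < K" and small: "\<And>j. j < K \<Longrightarrow>
          N (real (Suc m) * real (Suc j) / real K) \<omega> - N (real (Suc m) * real j / real K) \<omega> \<le> 1"
        using elim(1) by blast
      define z where "z = t * real K / real (Suc m)"
      \<comment> \<open>Cells are open on the left and closed on the right: if \<open>t\<close> is a
        grid point, its jump belongs to the cell ending there. This is why the index is not the
        floor of \<open>z\<close>, and why \<open>0 < t\<close> is established.\<close>
      define j where "j = nat (\<lceil>z\<rceil> - 1)"
      have z: "0 < z" "z < real K" using t K tm mult_strict_right_mono[OF tm, of "real K"]
        by (auto simp: z_def divide_less_eq mult.commute simp del: of_nat_Suc)
      then have j: "real j < z" "z \<le> real (Suc j)" unfolding j_def by linarith+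
      have "j < K" using j z by linarith
      have tz: "t = real (Suc m) * z / real K" using K by (simp add: z_def)
      have "real (Suc m) * real j / real K < t" "t \<le> real (Suc m) * real (Suc j) / real K"
        unfolding tz using j K
        by (auto simp: divide_strict_right_mono divide_right_mono mult_strict_left_mono
            mult_left_mono simp del: of_nat_Suc)
      \<comment> \<open>The left end precedes the \<open>k\<close>-th arrival while the right end
        has seen arrival \<open>Suc k\<close>.\<close>
      then have "N (real (Suc m) * real j / real K) \<omega> < k"
        "Suc k \<le> N (real (Suc m) * real (Suc j) / real K) \<omega>"
        using iff[of "real (Suc m) * real j / real K" k]
          iff[of "real (Suc m) * real (Suc j) / real K" "Suc k"] simultaneous t
        by (auto simp: t_def simp del: of_nat_Suc)
      with small[OF \<open>j < K\<close>] show False by linarith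
    qed
  qed
qed

text \<open>\<open>solves_interference\<close> constrains an algorithm on initial configurations
  only; this makes it applicable to almost every sample.\<close>

lemma (in poisson_process) AE_arrival_configuration:
  "AE \<omega> in M. arrival_configuration n N \<omega> \<in> initial_configurations n"
  using AE_arrival_time_strict_mono AE_count_unbounded
proof eventually_elim
  case (elim \<omega>)
  have "arrival_time N i \<omega> < arrival_time N j \<omega>" if "1 \<le> i" "i < j" for i j
    using that(2,1)
  proof (induction rule: less_Suc_induct)
    case (1 i)
    with elim(1) show ?case by blast
  next
    case (2 i j k)
    then show ?case by force
  qed
  with elim(2) show ?case
    unfolding initial_configurations_def arrival_configuration_def
    by (auto simp: strict_mono_on_def intro!: arrival_time_nonneg)
qed

section \<open>Deterministic bounds on final positions and movement\<close>

text \<open>Sorting preserves the sum, and the sorted entry with index \<open>k\<close>, counted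
  from \<open>0\<close>, is at least \<open>s * k\<close>: the first is nonnegative and each gap
  adds at least \<open>s\<close>.\<close>

lemma sum_ge_if_consecutive_distances:
  fixes y :: "nat \<Rightarrow> real"
  assumes gaps: "consecutive_distances_within n s v y" and nonneg: "\<forall>i\<in>{1..n}. 0 \<le> y i"
  shows "s * (real n * (real n - 1) / 2) \<le> (\<Sum>i=1..n. y i)"
proof -
  define ys where "ys = sort (map y [1..<Suc n])"
  have len: "length ys = n" by (simp add: ys_def)
  have lower: "s * real k \<le> ys ! k" if "k < n" for k
    using that
  proof (induction k)
    case 0
    then have "ys ! 0 \<in> set ys" using len by (intro nth_mem) simp
    then show ?case using nonneg by (auto simp: ys_def)
  next
    case (Suc k)
    then have "s \<le> ys ! Suc k - ys ! k"
      using gaps unfolding consecutive_distances_within_def ys_def by (auto simp: Let_def)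
    with Suc show ?case by (simp add: algebra_simps)
  qed
  have "s * (real n * (real n - 1) / 2) = (\<Sum>k<n. s * real k)"
    by (induction n) (auto simp: field_simps)
  also have "\<dots> \<le> (\<Sum>k<n. ys ! k)" by (intro sum_mono lower) auto
  also have "\<dots> = sum_list ys" by (simp add: sum_list_sum_nth len atLeast0LessThan)
  also have "\<dots> = sum_list (map y [1..<Suc n])"
    unfolding ys_def by (metis mset_sort sum_mset_sum_list)
  also have "\<dots> = (\<Sum>i=1..n. y i)"
    by (simp add: interv_sum_list_conv_sum_set_nat atLeastLessThanSuc_atLeastAtMost del: upt_Suc)
  finally show ?thesis .
qed

text \<open>For \<open>x \<ge> d\<close> lower both factors of \<open>x powr (a - 1) * x\<close>;
  for smaller \<open>x\<close> the left side is at most \<open>0\<close>. A bound linear in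
  \<open>x\<close> lets expectations be taken termwise.\<close>

lemma linear_le_powr:
  fixes d a :: real
  assumes "0 < d" "1 \<le> a" "0 \<le> x"
  shows "d powr (a - 1) * (x - d) \<le> x powr a"
proof (cases "d \<le> x")
  case True
  have "d powr (a - 1) * (x - d) \<le> x powr (a - 1) * x"
    using True assms by (intro mult_mono powr_mono2) auto
  also have "\<dots> = x powr a"
    using True assms by (simp add: powr_diff)
  finally show ?thesis .
next
  case False
  then have "d powr (a - 1) * (x - d) \<le> 0" using assms by (intro mult_nonneg_nonpos) auto
  then show ?thesis by (meson order_trans powr_ge_zero)
qed

lemma total_movement_ge:
  assumes "0 < d" "1 \<le> a"
  shows "d powr (a - 1) * ((\<Sum>i=1..n. y i) - (\<Sum>i=1..n. x i) - real n * d) \<le> total_movement a n x y"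
proof -
  have "d powr (a - 1) * ((\<Sum>i=1..n. y i) - (\<Sum>i=1..n. x i) - real n * d)
      = (\<Sum>i=1..n. d powr (a - 1) * (y i - x i - d))"
    by (simp add: sum_subtractf sum_distrib_left[symmetric])
  \<comment> \<open>Bounding displacements below by signed differences leaves only the two sums of
    positions, whatever the assignment of sensors.\<close>
  also have "\<dots> \<le> (\<Sum>i=1..n. d powr (a - 1) * (\<bar>y i - x i\<bar> - d))"
    by (intro sum_mono mult_left_mono) auto
  also have "\<dots> \<le> total_movement a n x y"
    unfolding total_movement_def using assms by (intro sum_mono linear_le_powr) auto
  finally show ?thesis .
qed

section \<open>The expected movement and its asymptotics\<close>

text \<open>Here \<open>f\<close> stands for the movement of an arbitrary, possibly non-measurable
  algorithm, so the estimate passes through an integrable minorant \<open>g\<close>. Since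
  \<open>ennreal\<close> sends negative values to \<open>0\<close>, \<open>g\<close> is first
  replaced by its positive part.\<close>

lemma (in prob_space) ennreal_expectation_le_nn_integral:
  assumes "integrable M g" and "AE \<omega> in M. g \<omega> \<le> f \<omega>"
  shows "ennreal (expectation g) \<le> (\<integral>\<^sup>+ \<omega>. ennreal (f \<omega>) \<partial>M)"
proof -
  have "ennreal (expectation g) \<le> ennreal (expectation (\<lambda>\<omega>. max 0 (g \<omega>)))"
    using assms(1) by (intro ennreal_leI integral_mono) auto
  also have "\<dots> = (\<integral>\<^sup>+ \<omega>. ennreal (max 0 (g \<omega>)) \<partial>M)"
    using assms(1) by (intro nn_integral_eq_integral[symmetric]) auto
  also have "\<dots> \<le> (\<integral>\<^sup>+ \<omega>. ennreal (f \<omega>) \<partial>M)"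
    using assms(2) by (intro nn_integral_mono_AE)
      (auto elim!: eventually_mono intro: ennreal_leI simp: max_def ennreal_neg)
  finally show ?thesis .
qed

lemma (in poisson_process) expected_total_movement_ge:
  assumes "0 < d" "1 \<le> a" and A: "solves_interference n s v A"
  shows "ennreal (d powr (a - 1) *
      (s * (real n * (real n - 1) / 2) - real n * (real n + 1) / (2 * rate) - real n * d))
    \<le> expected_total_movement a n M N A"
proof -
  let ?X = "arrival_configuration n N"
  \<comment> \<open>This is the bound of \<open>total_movement_ge\<close> with the sum of final
    positions replaced by its deterministic minimum; the arrival times are the only randomness
    left.\<close>
  define g where "g \<omega> = d powr (a - 1) *
    (s * (real n * (real n - 1) / 2) - (\<Sum>i=1..n. arrival_time N i \<omega>) - real n * d)" for \<omega>
  have int: "integrable M (\<lambda>\<omega>. \<Sum>i=1..n. arrival_time N i \<omega>)"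
    using expectation_arrival_time(1) by auto
  have "expectation (\<lambda>\<omega>. \<Sum>i=1..n. arrival_time N i \<omega>) = (\<Sum>i=1..n. real i / rate)"
    using expectation_arrival_time by (subst Bochner_Integration.integral_sum) auto
  also have "\<dots> = (\<Sum>i=1..n. real i) / rate"
    by (simp add: sum_divide_distrib)
  also have "(\<Sum>i=1..n. real i) = real n * (real n + 1) / 2"
    by (induction n) (auto simp: field_simps)
  finally have exp_sum: "expectation (\<lambda>\<omega>. \<Sum>i=1..n. arrival_time N i \<omega>)
      = real n * (real n + 1) / (2 * rate)" by simp
  have "integrable M g" unfolding g_def using int by auto
  have "AE \<omega> in M. g \<omega> \<le> total_movement a n (?X \<omega>) (A (?X \<omega>))"
    using AE_arrival_configuration[of n]
  proof eventually_elim
    case (elim \<omega>)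
    have sum_X: "(\<Sum>i=1..n. ?X \<omega> i) = (\<Sum>i=1..n. arrival_time N i \<omega>)"
      by (intro sum.cong) (auto simp: arrival_configuration_def)
    have "s * (real n * (real n - 1) / 2) \<le> (\<Sum>i=1..n. A (?X \<omega>) i)"
      using A elim by (intro sum_ge_if_consecutive_distances) (auto simp: solves_interference_def)
    then have "g \<omega> \<le> d powr (a - 1) * ((\<Sum>i=1..n. A (?X \<omega>) i) - (\<Sum>i=1..n. ?X \<omega> i) - real n * d)"
      unfolding g_def sum_X by (intro mult_left_mono) auto
    also have "\<dots> \<le> total_movement a n (?X \<omega>) (A (?X \<omega>))"
      using assms by (intro total_movement_ge)
    finally show ?case .
  qed
  then have "ennreal (expectation g) \<le> expected_total_movement a n M N A"
    unfolding expected_total_movement_def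
    by (rule ennreal_expectation_le_nn_integral[OF \<open>integrable M g\<close>])
  also have "expectation g = d powr (a - 1) *
      (s * (real n * (real n - 1) / 2) - real n * (real n + 1) / (2 * rate) - real n * d)"
    unfolding g_def using int by (simp add: exp_sum prob_space del: One_nat_def)
  finally show ?thesis .
qed

theorem theorem8:
  fixes \<epsilon> \<tau> a :: real
    and M :: "nat \<Rightarrow> 'w measure" and N :: "nat \<Rightarrow> real \<Rightarrow> 'w \<Rightarrow> nat"
  assumes "0 < \<epsilon>" and "\<epsilon> \<le> \<tau>" and "1 < a"
    and "\<And>n. 1 \<le> n \<Longrightarrow> poisson_process (M n) (real n) (N n)"
  shows "\<exists>c>0. \<forall>\<^sub>F n in sequentially. \<forall>A.
           solves_interference n ((1 + \<epsilon>) / real n) ((1 + \<tau>) / real n) A \<longrightarrow>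
           ennreal (c * real n) \<le> expected_total_movement a n (M n) (N n) A"
proof (intro exI conjI)
  \<comment> \<open>The mean displacement per sensor is about \<open>\<epsilon> / 2\<close>.
    Subtracting \<open>d\<close> leaves \<open>\<epsilon> / 4\<close>, half of which is given up to
    absorb lower-order terms; hence \<open>\<epsilon> / 8\<close> in the constant.\<close>
  define d where "d = \<epsilon> / 4"
  have d: "0 < d" using assms by (simp add: d_def)
  show "0 < d powr (a - 1) * (\<epsilon> / 8)" using assms d by simp
  \<comment> \<open>The threshold is equivalent to
    \<open>1 + \<epsilon> / 2 \<le> \<epsilon> * n / 8\<close>, and it does not depend on
    \<open>A\<close>.\<close>
  have "\<forall>\<^sub>F n in sequentially. (8 + 4 * \<epsilon>) / \<epsilon> \<le> real n"
    using filterlim_real_sequentially by (simp add: filterlim_at_top)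
  then show "\<forall>\<^sub>F n in sequentially. \<forall>A.
      solves_interference n ((1 + \<epsilon>) / real n) ((1 + \<tau>) / real n) A \<longrightarrow>
      ennreal (d powr (a - 1) * (\<epsilon> / 8) * real n) \<le> expected_total_movement a n (M n) (N n) A"
    using eventually_ge_at_top[of 1]
  proof eventually_elim
    case (elim n)
    interpret poisson_process "M n" "real n" "N n" using elim assms by simp
    have "\<epsilon> / 8 * real n \<le> \<epsilon> * real n / 2 - 1 - \<epsilon> / 2 - real n * d"
      using elim assms(1) by (simp add: d_def field_simps)
    also have "\<dots> = (1 + \<epsilon>) / real n * (real n * (real n - 1) / 2)
        - real n * (real n + 1) / (2 * real n) - real n * d"
      using elim by (simp add: field_simps)
    finally have "d powr (a - 1) * (\<epsilon> / 8) * real n \<le> d powr (a - 1) *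
        ((1 + \<epsilon>) / real n * (real n * (real n - 1) / 2)
        - real n * (real n + 1) / (2 * real n) - real n * d)"
      unfolding mult.assoc by (intro mult_left_mono) auto
    then show ?case
      using expected_total_movement_ge[OF d] assms(3) by (meson ennreal_leI less_imp_le order_trans)
  qed
qed

end
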